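(* Let $T$ be the $d$-adic tree and let $G\le\operatorname{Aut}T$ be a self-similar group such that there is a rooted automorphism $a\in G$ whose label $a_{(\emptyset)}$ at the root is a $d$-cycle. If for each $n\in\mathbb{N}$ we have $\langle\psi_{u}(\operatorname{st}_G(L_n))\mid u\in L_n\rangle=G$, then $G$ is super strongly fractal.
   Context: The vertices of the $d$-adic tree $T$ are the words in the free monoid $X^*$, $|X|=d$; the root is the empty word $\emptyset$, and $u$ is joined to $ux$ for $x\in X$. $L_n$ is the set of words of length $n$. $\operatorname{Aut}T$ is the group of automorphisms of the rooted tree $T$, with product $(fg)(u)=g(f(u))$. For $g\in\operatorname{Aut}T$ and a vertex $u$, the label $g_{(u)}$ is the permutation $\alpha$ of $X$ with $g(ux)=g(u)\alpha(x)$ for all $x\in X$; the section $g_u\in\operatorname{Aut}T$ is defined by $g(uv)=g(u)g_u(v)$ for all $v\in X^*$. An automorphism is rooted if all its sections at the first-level vertices are trivial (so it just permutes the first-level subtrees rigidly according to its label at the root). $\operatorname{st}_G(L_n)$ is the subgroup of elements of $G$ fixing every vertex of $L_n$, and $\psi_u$ is the homomorphism $g\mapsto g_u$ defined on the stabilizer of $u$. $G$ is self-similar if $g_u\in G$ for all $g\in G$ and all vertices $u$; a self-similar group $G$ is super strongly fractal if $\psi_u(\operatorname{st}_G(L_n))=G$ for every $n\in\mathbb{N}$ and every $u\in L_n$. *)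

theory Defs
  imports "HOL-Library.Cardinality" "HOL-Combinatorics.Cycles" "HOL-Algebra.Generated_Groups"
begin

text \<open>
  The alphabet X is the finite type \<^typ>\<open>'x\<close>, so that d is \<open>CARD('x)\<close>, and the vertices
  of the d-adic tree are the words \<^typ>\<open>'x list\<close>, with root \<open>[]\<close>.
\<close>

definition adjacent :: "'x list \<Rightarrow> 'x list \<Rightarrow> bool" where
  "adjacent u v \<longleftrightarrow> (\<exists>x. v = u @ [x]) \<or> (\<exists>x. u = v @ [x])"

definition level :: "nat \<Rightarrow> 'x list set" where
  "level n = {u. length u = n}"

definition tree_aut :: "('x list \<Rightarrow> 'x list) \<Rightarrow> bool" where
  "tree_aut f \<longleftrightarrow> bij f \<and> f [] = [] \<and> (\<forall>u v. adjacent (f u) (f v) \<longleftrightarrow> adjacent u v)"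

text \<open>Products are read from left to right: the product of f and g maps u to g (f u).\<close>

definition Aut_tree :: "('x list \<Rightarrow> 'x list) monoid" where
  "Aut_tree = \<lparr>carrier = {f. tree_aut f}, mult = (\<lambda>f g. g \<circ> f), one = id\<rparr>"

text \<open>
  Both descriptions determine at most one object; existence for tree automorphisms
  is shown in \<open>label_eq\<close> and \<open>section_at_eq\<close> below.
\<close>

definition label :: "('x list \<Rightarrow> 'x list) \<Rightarrow> 'x list \<Rightarrow> 'x \<Rightarrow> 'x" where
  "label g u = (THE \<alpha>. \<forall>x. g (u @ [x]) = g u @ [\<alpha> x])"

definition section_at :: "('x list \<Rightarrow> 'x list) \<Rightarrow> 'x list \<Rightarrow> 'x list \<Rightarrow> 'x list" where
  "section_at g u = (THE h. \<forall>v. g (u @ v) = g u @ h v)"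

definition rooted :: "('x list \<Rightarrow> 'x list) \<Rightarrow> bool" where
  "rooted g \<longleftrightarrow> tree_aut g \<and> (\<forall>u \<in> level 1. section_at g u = id)"

definition is_cycle_of_length :: "nat \<Rightarrow> ('x \<Rightarrow> 'x) \<Rightarrow> bool" where
  "is_cycle_of_length k p \<longleftrightarrow> (\<exists>cs. cycle cs \<and> length cs = k \<and> p = cycle_of_list cs)"

definition level_stabilizer ::
    "('x list \<Rightarrow> 'x list) set \<Rightarrow> nat \<Rightarrow> ('x list \<Rightarrow> 'x list) set" where
  "level_stabilizer G n = {g \<in> G. \<forall>u \<in> level n. g u = u}"

text \<open>
  A homomorphism only on the stabilizer of u, although defined as a function on all maps.
\<close>

definition psi :: "'x list \<Rightarrow> ('x list \<Rightarrow> 'x list) \<Rightarrow> ('x list \<Rightarrow> 'x list)" where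
  "psi u g = section_at g u"

definition self_similar :: "('x list \<Rightarrow> 'x list) set \<Rightarrow> bool" where
  "self_similar G \<longleftrightarrow> subgroup G Aut_tree \<and> (\<forall>g \<in> G. \<forall>u. section_at g u \<in> G)"

definition super_strongly_fractal :: "('x list \<Rightarrow> 'x list) set \<Rightarrow> bool" where
  "super_strongly_fractal G \<longleftrightarrow>
     self_similar G \<and> (\<forall>n. \<forall>u \<in> level n. psi u ` level_stabilizer G n = G)"

lemma tree_aut_step:
  assumes g: "tree_aut g"
  shows "length (g u) = length u \<and> (\<forall>x. \<exists>y. g (u @ [x]) = g u @ [y])"
proof (induction u rule: rev_induct)
  case Nil
  have "\<exists>y. g [x] = [y]" for x
  proof -
    have "adjacent [] [x]"
      unfolding adjacent_def by simp
    then have "adjacent (g []) (g [x])"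
      using g unfolding tree_aut_def by blast
    then show ?thesis using g by (auto simp: tree_aut_def adjacent_def)
  qed
  then show ?case using g by (simp add: tree_aut_def)
next
  case (snoc z u)
  obtain y where y: "g (u @ [z]) = g u @ [y]" using snoc by blast
  have "\<exists>w. g (u @ [z, x]) = g (u @ [z]) @ [w]" for x
  proof -
    have "adjacent (u @ [z]) (u @ [z, x])"
      unfolding adjacent_def by simp
    then have "adjacent (g (u @ [z])) (g (u @ [z, x]))"
      using g unfolding tree_aut_def by blast
    moreover have "g (u @ [z, x]) \<noteq> g u"
      using g by (auto simp: tree_aut_def bij_def inj_def)
    ultimately show ?thesis
      using y by (auto simp: adjacent_def)
  qed
  then show ?case using y snoc by auto
qed

lemma label_eq:
  assumes "tree_aut g"
  shows "g (u @ [x]) = g u @ [label g u x]"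
proof -
  have "\<exists>!\<alpha>. \<forall>x. g (u @ [x]) = g u @ [\<alpha> x]"
  proof -
    obtain \<alpha> where a: "\<forall>x. g (u @ [x]) = g u @ [\<alpha> x]"
      using tree_aut_step[OF assms, of u] by metis
    then show ?thesis by (intro ex1I[of _ \<alpha>]) auto
  qed
  from theI'[OF this] show ?thesis unfolding label_def by blast
qed

lemma section_at_eq:
  assumes "tree_aut g"
  shows "g (u @ v) = g u @ section_at g u v"
proof -
  have "\<exists>w. g (u @ v) = g u @ w" for v
  proof (induction v rule: rev_induct)
    case (snoc x v)
    then show ?case using label_eq[OF assms, of "u @ v" x] by auto
  qed simp
  then obtain h where h: "\<forall>v. g (u @ v) = g u @ h v" by metis
  then have "\<exists>!h. \<forall>v. g (u @ v) = g u @ h v"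
    by (intro ex1I[of _ h]) auto
  from theI'[OF this] show ?thesis unfolding section_at_def by blast
qed

lemma tree_aut_section_at:
  assumes g: "tree_aut g"
  shows "tree_aut (section_at g u)"
proof -
  note eq = section_at_eq[OF g, of u]
  have b: "inj g" "surj g" using g by (auto simp: tree_aut_def bij_def)
  have len: "length (g v) = length v" for v
    using tree_aut_step[OF g] by blast
  have pre: "\<exists>s. v = u @ s" if v: "g v = g u @ w" for v w
  proof -
    have "length u \<le> length v" using arg_cong[OF v, of length] len by simp
    moreover have "g v = g (take (length u) v) @ section_at g (take (length u) v) (drop (length u) v)"
      using section_at_eq[OF g, of "take (length u) v" "drop (length u) v"] by simp
    ultimately have "g (take (length u) v) = g u" using v len by (simp add: append_eq_append_conv)
    then have "take (length u) v = u" using b(1) by (simp add: inj_eq)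
    then show ?thesis by (metis append_take_drop_id)
  qed
  have "inj (section_at g u)"
    by (rule injI) (metis eq b(1) inj_eq same_append_eq)
  moreover have "surj (section_at g u)"
    unfolding surj_def by (metis eq pre b(2) surjD same_append_eq)
  moreover have "section_at g u [] = []"
    using eq[of "[]"] by simp
  moreover have "adjacent (section_at g u v) (section_at g u w) \<longleftrightarrow> adjacent v w" for v w
  proof -
    have p: "adjacent (z @ v) (z @ w) \<longleftrightarrow> adjacent v w" for z v w :: "'a list"
      by (simp add: adjacent_def)
    have "adjacent (g (u @ v)) (g (u @ w)) \<longleftrightarrow> adjacent (u @ v) (u @ w)"
      using g by (simp add: tree_aut_def)
    then show ?thesis by (simp add: eq p)
  qed
  ultimately show ?thesis by (simp add: tree_aut_def bij_def)
qed

lemma group_Aut_tree: "group (Aut_tree :: ('x list \<Rightarrow> 'x list) monoid)"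
proof (rule groupI)
  fix f :: "'x list \<Rightarrow> 'x list"
  assume "f \<in> carrier Aut_tree"
  then have f: "tree_aut f" by (simp add: Aut_tree_def)
  then have b: "bij f" by (simp add: tree_aut_def)
  have fi: "f (inv_into UNIV f u) = u" for u
    using b by (simp add: bij_is_surj surj_f_inv_f)
  then have "tree_aut (inv_into UNIV f)"
    using f b unfolding tree_aut_def
    by (metis bij_imp_bij_inv bij_inv_eq_iff)
  moreover have "f \<circ> inv_into UNIV f = id"
    using fi by (simp add: fun_eq_iff)
  ultimately show "\<exists>h\<in>carrier Aut_tree. h \<otimes>\<^bsub>Aut_tree\<^esub> f = \<one>\<^bsub>Aut_tree\<^esub>"
    by (auto simp: Aut_tree_def)
qed (auto simp: Aut_tree_def tree_aut_def bij_comp comp_assoc)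

end

theory Submission
  imports Defs
begin

text \<open>
  Write \<open>H u\<close> for the image under \<open>psi u\<close> of the stabilizer in \<open>G\<close> of the level of \<open>u\<close>. If some
  \<open>g\<close> in \<open>G\<close> takes \<open>u\<close> to \<open>v\<close> and has trivial section at \<open>u\<close>, then \<open>g\<close> copies the subtree below
  \<open>u\<close> rigidly onto the one below \<open>v\<close>; conjugation by \<open>g\<close> preserves the level stabilizer and
  carries the section at \<open>u\<close> unchanged to \<open>v\<close>, so \<open>H u \<subseteq> H v\<close>
  (\<open>psi_image_mono_of_rigid_map\<close>). Suppose that every two vertices of a level are related in this
  way; call \<open>G\<close> rigidly transitive on that level. Then all \<open>H u\<close> on the level are one and the same
  subgroup, and as together they generate \<open>G\<close>, each of them is \<open>G\<close>.

  Rigid transitivity passes from level \<open>n\<close> to level \<open>n + 1\<close> because of the rooted element \<open>a\<close>: to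
  send \<open>ux\<close> to \<open>vy\<close>, first move \<open>u\<close> rigidly to \<open>v\<close>, which takes \<open>ux\<close> to \<open>vx\<close>. Since \<open>H v = G\<close> is
  already known on level \<open>n\<close>, every power of \<open>a\<close> is the section at \<open>v\<close> of some element of \<open>G\<close>
  fixing level \<open>n\<close>; the label of \<open>a\<close> is transitive on letters, so a suitable power takes \<open>x\<close> to
  \<open>y\<close>, and its sections below the root are trivial. Starting from the root, this gives rigid
  transitivity on every level by induction, with \<open>H v = G\<close> derived afresh at each step.
\<close>

section \<open>Sections of tree automorphisms\<close>

lemma section_at_eqI:
  assumes "\<And>v. g (u @ v) = g u @ h v"
  shows "section_at g u = h"
  unfolding section_at_def
proof (rule the_equality)
  fix k assume "\<forall>v. g (u @ v) = g u @ k v"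
  then show "k = h" using assms by (simp add: fun_eq_iff)
qed (use assms in blast)

lemma section_at_comp:
  assumes "tree_aut f" and "tree_aut g"
  shows "section_at (g \<circ> f) u = section_at g (f u) \<circ> section_at f u"
  by (rule section_at_eqI) (simp add: section_at_eq[OF assms(1)] section_at_eq[OF assms(2)])

lemma length_tree_aut: "tree_aut g \<Longrightarrow> length (g u) = length u"
  using tree_aut_step by blast

lemma left_inverse_eq_inv_into:
  assumes "bij h" and "k \<circ> h = id"
  shows "k = inv_into UNIV h"
proof
  fix y
  have "k (h (inv_into UNIV h y)) = inv_into UNIV h y"
    using assms(2) by (simp add: fun_eq_iff)
  then show "k y = inv_into UNIV h y"
    using assms(1) by (simp add: bij_is_surj surj_f_inv_f)
qed

lemma inv_Aut_tree:
  assumes "tree_aut g"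
  shows "inv\<^bsub>Aut_tree\<^esub> g = inv_into UNIV g" and "tree_aut (inv_into UNIV g)"
proof -
  interpret group "Aut_tree :: ('a list \<Rightarrow> 'a list) monoid" by (rule group_Aut_tree)
  have car: "g \<in> carrier Aut_tree" using assms by (simp add: Aut_tree_def)
  have "inv\<^bsub>Aut_tree\<^esub> g \<circ> g = id"
    using r_inv[OF car] by (simp add: Aut_tree_def)
  moreover have "bij g" using assms by (simp add: tree_aut_def)
  ultimately show eq: "inv\<^bsub>Aut_tree\<^esub> g = inv_into UNIV g"
    by (intro left_inverse_eq_inv_into)
  show "tree_aut (inv_into UNIV g)"
    using inv_closed[OF car] unfolding eq by (simp add: Aut_tree_def)
qed

section \<open>Images of level stabilizers\<close>

text \<open>
  The map \<open>psi u\<close> is multiplicative on elements fixing \<open>u\<close>, which is what makes this image a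
  subgroup.
\<close>

lemma subgroup_psi_image:
  fixes G :: "('x list \<Rightarrow> 'x list) set"
  assumes G: "subgroup G Aut_tree" and u: "u \<in> level n"
  shows "subgroup (psi u ` level_stabilizer G n) Aut_tree"
proof -
  interpret group "Aut_tree :: ('x list \<Rightarrow> 'x list) monoid" by (rule group_Aut_tree)
  have aut: "tree_aut g" if "g \<in> G" for g
    using subgroup.subset[OF G] that by (auto simp: Aut_tree_def)
  show ?thesis
  proof (rule subgroupI)
    show "psi u ` level_stabilizer G n \<subseteq> carrier Aut_tree"
      by (auto simp: psi_def level_stabilizer_def Aut_tree_def intro: tree_aut_section_at aut)
    have "id \<in> level_stabilizer G n"
      using subgroup.one_closed[OF G] by (simp add: level_stabilizer_def Aut_tree_def)
    then show "psi u ` level_stabilizer G n \<noteq> {}" by blast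
  next
    fix h assume "h \<in> psi u ` level_stabilizer G n"
    then obtain s where s: "s \<in> G" "\<forall>w\<in>level n. s w = w" and h: "h = section_at s u"
      by (auto simp: psi_def level_stabilizer_def)
    let ?t = "inv_into UNIV s"
    have bij: "bij s" using aut[OF s(1)] by (simp add: tree_aut_def)
    have tG: "?t \<in> G"
      using subgroup.m_inv_closed[OF G s(1)] by (simp add: inv_Aut_tree(1)[OF aut[OF s(1)]])
    have tfix: "\<forall>w\<in>level n. ?t w = w"
      using s(2) bij by (simp add: bij_is_inj inv_f_eq)
    have "section_at ?t u \<circ> h = section_at (?t \<circ> s) u"
      using section_at_comp[OF aut[OF s(1)] aut[OF tG], of u] s(2) u h by simp
    also have "\<dots> = id"
      using bij by (intro section_at_eqI) (simp add: bij_is_inj)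
    finally have tinv: "section_at ?t u \<circ> h = id" .
    have "tree_aut h" unfolding h by (rule tree_aut_section_at[OF aut[OF s(1)]])
    then have "inv\<^bsub>Aut_tree\<^esub> h = section_at ?t u"
      using left_inverse_eq_inv_into[OF _ tinv] by (simp add: inv_Aut_tree(1) tree_aut_def)
    then show "inv\<^bsub>Aut_tree\<^esub> h \<in> psi u ` level_stabilizer G n"
      using tG tfix by (auto simp: psi_def level_stabilizer_def)
  next
    fix h k assume "h \<in> psi u ` level_stabilizer G n" "k \<in> psi u ` level_stabilizer G n"
    then obtain s t where s: "s \<in> G" "\<forall>w\<in>level n. s w = w" and h: "h = section_at s u"
      and t: "t \<in> G" "\<forall>w\<in>level n. t w = w" and k: "k = section_at t u"
      by (auto simp: psi_def level_stabilizer_def)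
    have "t \<circ> s \<in> G"
      using subgroup.m_closed[OF G s(1) t(1)] by (simp add: Aut_tree_def)
    moreover have "section_at (t \<circ> s) u = k \<circ> h"
      using section_at_comp[OF aut[OF s(1)] aut[OF t(1)], of u] s(2) u h k by simp
    ultimately show "h \<otimes>\<^bsub>Aut_tree\<^esub> k \<in> psi u ` level_stabilizer G n"
      using s(2) t(2) by (auto simp: psi_def level_stabilizer_def Aut_tree_def
          intro!: image_eqI[of _ _ "t \<circ> s"])
  qed
qed

text \<open>
  In general conjugating by \<open>g\<close> conjugates the image at \<open>u\<close> by the section of \<open>g\<close> at \<open>u\<close>; the
  triviality of that section is what gives an inclusion of the images themselves.
\<close>

lemma psi_image_mono_of_rigid_map:
  fixes G :: "('x list \<Rightarrow> 'x list) set"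
  assumes G: "subgroup G Aut_tree" and g: "g \<in> G" and rigid: "section_at g u = id"
    and u: "u \<in> level n"
  shows "psi u ` level_stabilizer G n \<subseteq> psi (g u) ` level_stabilizer G n"
proof
  fix h assume "h \<in> psi u ` level_stabilizer G n"
  then obtain s where s: "s \<in> G" "\<forall>w\<in>level n. s w = w" and h: "h = section_at s u"
    by (auto simp: psi_def level_stabilizer_def)
  have aut: "tree_aut f" if "f \<in> G" for f
    using subgroup.subset[OF G] that by (auto simp: Aut_tree_def)
  let ?i = "inv_into UNIV g"
  have bij: "bij g" using aut[OF g] by (simp add: tree_aut_def)
  have iG: "?i \<in> G"
    using subgroup.m_inv_closed[OF G g] by (simp add: inv_Aut_tree(1)[OF aut[OF g]])
  let ?c = "g \<circ> (s \<circ> ?i)"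
  have "?c \<in> G"
    using subgroup.m_closed[OF G subgroup.m_closed[OF G iG s(1)] g] by (simp add: Aut_tree_def)
  moreover have "?c w = w" if "w \<in> level n" for w
    using that s(2) bij length_tree_aut[OF aut[OF iG], of w]
    by (simp add: level_def bij_is_surj surj_f_inv_f)
  moreover have "section_at ?c (g u) = h"
  proof (rule section_at_eqI)
    fix v
    have gu: "g (u @ w) = g u @ w" for w
      using section_at_eq[OF aut[OF g], of u w] rigid by simp
    have "?i (g u @ v) = u @ v" using gu bij by (simp add: bij_is_inj inv_f_eq)
    moreover have "?i (g u) = u" using bij by (simp add: bij_is_inj)
    ultimately show "?c (g u @ v) = ?c (g u) @ h v"
      using section_at_eq[OF aut[OF s(1)], of u v] s(2) u gu h by simp
  qed
  ultimately show "h \<in> psi (g u) ` level_stabilizer G n"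
    by (auto simp: psi_def level_stabilizer_def intro!: image_eqI[of _ _ ?c])
qed

section \<open>Transitivity by rigid maps\<close>

definition rigidly_transitive_on :: "('x list \<Rightarrow> 'x list) set \<Rightarrow> 'x list set \<Rightarrow> bool" where
  "rigidly_transitive_on G L \<longleftrightarrow> (\<forall>u\<in>L. \<forall>v\<in>L. \<exists>g\<in>G. g u = v \<and> section_at g u = id)"

lemma psi_image_eq_of_rigidly_transitive:
  fixes G :: "('x list \<Rightarrow> 'x list) set"
  assumes G: "subgroup G Aut_tree"
    and gen: "generate Aut_tree (\<Union>u \<in> level n. psi u ` level_stabilizer G n) = G"
    and trans: "rigidly_transitive_on G (level n)" and v: "v \<in> level n"
  shows "psi v ` level_stabilizer G n = G"
proof -
  interpret group "Aut_tree :: ('x list \<Rightarrow> 'x list) monoid" by (rule group_Aut_tree)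
  have "(\<Union>u \<in> level n. psi u ` level_stabilizer G n) \<subseteq> psi v ` level_stabilizer G n"
  proof (rule UN_least)
    fix u :: "'x list" assume u: "u \<in> level n"
    then obtain g where g: "g \<in> G" "g u = v" "section_at g u = id"
      using trans v unfolding rigidly_transitive_on_def by blast
    then show "psi u ` level_stabilizer G n \<subseteq> psi v ` level_stabilizer G n"
      using psi_image_mono_of_rigid_map[OF G g(1,3) u] by (simp only: g(2))
  qed
  from generate_subgroup_incl[OF this subgroup_psi_image[OF G v]]
  have "G \<subseteq> psi v ` level_stabilizer G n" unfolding gen .
  moreover have "psi v ` level_stabilizer G n \<subseteq> G"
  proof
    fix h assume "h \<in> psi v ` level_stabilizer G n"
    then have "h \<in> (\<Union>u \<in> level n. psi u ` level_stabilizer G n)"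
      using v by (rule UN_I[rotated])
    from generate.incl[OF this, of Aut_tree] show "h \<in> G" unfolding gen .
  qed
  ultimately show ?thesis by (rule equalityI[rotated])
qed

lemma funpow_mem_subgroup:
  assumes G: "subgroup G Aut_tree" and a: "a \<in> G"
  shows "a ^^ k \<in> G"
proof (induction k)
  case 0
  then show ?case using subgroup.one_closed[OF G] by (simp add: Aut_tree_def id_def)
next
  case (Suc k)
  then show ?case
    using subgroup.m_closed[OF G Suc a] by (simp add: Aut_tree_def comp_def)
qed

lemma rooted_funpow:
  assumes "rooted a"
  shows "(a ^^ k) (x # v) = (label a [] ^^ k) x # v"
proof (induction k)
  case (Suc k)
  have aut: "tree_aut a" and triv: "section_at a [y] = id" for y
    using assms by (auto simp: rooted_def level_def)
  have "a (y # w) = label a [] y # w" for y w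
    using section_at_eq[OF aut, of "[y]" w] label_eq[OF aut, of "[]" y] triv[of y] aut
    by (simp add: tree_aut_def)
  then show ?case using Suc by simp
qed simp

lemma full_cycle_transitive:
  fixes p :: "'x::finite \<Rightarrow> 'x"
  assumes "is_cycle_of_length CARD('x) p"
  obtains k where "(p ^^ k) x = y"
proof -
  obtain cs where cs: "cycle cs" "length cs = CARD('x)" and p: "p = cycle_of_list cs"
    using assms unfolding is_cycle_of_length_def by blast
  have "set cs = UNIV"
    using cs by (simp add: card_eq_UNIV_imp_eq_UNIV distinct_card)
  then have "x \<in> set cs" and "y \<in> set cs" by simp_all
  then obtain i j where i: "i < length cs" "x = cs ! i" and j: "j < length cs" "y = cs ! j"
    by (auto simp: in_set_conv_nth)
  \<comment> \<open>Going round from \<open>i\<close> to \<open>j\<close>; adding the length keeps the subtraction from truncating.\<close>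
  let ?k = "length cs + j - i"
  have "(p ^^ ?k) x = rotate ?k cs ! i"
    unfolding p i(2) cyclic_rotation[OF cs(1), symmetric] using i(1) by simp
  also have "\<dots> = cs ! ((?k + i) mod length cs)"
    using i by (simp add: nth_rotate)
  also have "\<dots> = y" using i(1) j by simp
  finally show ?thesis by (rule that)
qed

text \<open>
  The motion of the last letter comes from an element that fixes the whole of level \<open>n\<close>, so it
  cannot disturb the motion of the prefix; and since it acts below \<open>v\<close> as a power of \<open>a\<close>, it is
  again rigid below each child of \<open>v\<close>.
\<close>

lemma rigidly_transitive_on_Suc:
  fixes G :: "('x::finite list \<Rightarrow> 'x list) set"
  assumes G: "subgroup G Aut_tree"
    and a: "a \<in> G" "rooted a" "is_cycle_of_length CARD('x) (label a [])"
    and trans: "rigidly_transitive_on G (level n)"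
    and full: "\<And>v. v \<in> level n \<Longrightarrow> G \<subseteq> psi v ` level_stabilizer G n"
  shows "rigidly_transitive_on G (level (Suc n))"
  unfolding rigidly_transitive_on_def
proof (intro ballI)
  fix u' v' :: "'x list" assume "u' \<in> level (Suc n)" "v' \<in> level (Suc n)"
  then obtain u x v y where u: "u' = u @ [x]" "u \<in> level n" and v: "v' = v @ [y]" "v \<in> level n"
    by (auto simp: level_def length_Suc_conv_rev)
  have aut: "tree_aut f" if "f \<in> G" for f
    using subgroup.subset[OF G] that by (auto simp: Aut_tree_def)
  obtain g where g: "g \<in> G" "g u = v" "section_at g u = id"
    using trans u(2) v(2) unfolding rigidly_transitive_on_def by blast
  obtain k where k: "(label a [] ^^ k) x = y"
    using full_cycle_transitive[OF a(3)] by blast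
  have "a ^^ k \<in> psi v ` level_stabilizer G n"
    using full[OF v(2)] funpow_mem_subgroup[OF G a(1)] by blast
  then obtain s where s: "s \<in> G" "s v = v" and sec: "section_at s v = a ^^ k"
    using v(2) by (auto simp: psi_def level_stabilizer_def)
  have move: "(s \<circ> g) (u' @ w) = v' @ w" for w
    using section_at_eq[OF aut[OF g(1)], of u "x # w"] section_at_eq[OF aut[OF s(1)], of v "x # w"]
      g(2,3) s(2) sec rooted_funpow[OF a(2), of k x w] k u(1) v(1) by simp
  have "s \<circ> g \<in> G"
    using subgroup.m_closed[OF G g(1) s(1)] by (simp add: Aut_tree_def)
  moreover have "(s \<circ> g) u' = v'" using move[of "[]"] by simp
  moreover have "section_at (s \<circ> g) u' = id"
    using move move[of "[]"] by (intro section_at_eqI) simp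
  ultimately show "\<exists>f\<in>G. f u' = v' \<and> section_at f u' = id" by blast
qed

theorem lemma2p12:
  fixes G :: "('x::finite list \<Rightarrow> 'x list) set"
  assumes "subgroup G Aut_tree"
    and "self_similar G"
    and "\<exists>a \<in> G. rooted a \<and> is_cycle_of_length CARD('x) (label a [])"
    and "\<And>n. generate Aut_tree (\<Union>u \<in> level n. psi u ` level_stabilizer G n) = G"
  shows "super_strongly_fractal G"
proof -
  note G = assms(1)
  obtain a where a: "a \<in> G" "rooted a" "is_cycle_of_length CARD('x) (label a [])"
    using assms(3) by blast
  have "rigidly_transitive_on G (level n)" for n
  proof (induction n)
    case 0
    have "id \<in> G" using subgroup.one_closed[OF G] by (simp add: Aut_tree_def)
    moreover have "section_at id [] = (id :: 'x list \<Rightarrow> 'x list)"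
      by (rule section_at_eqI) simp
    ultimately show ?case by (auto simp: rigidly_transitive_on_def level_def intro!: bexI[of _ id])
  next
    case (Suc n)
    show ?case
      using psi_image_eq_of_rigidly_transitive[OF G assms(4) Suc]
      by (intro rigidly_transitive_on_Suc[OF G a Suc]) blast
  qed
  then show ?thesis
    using psi_image_eq_of_rigidly_transitive[OF G assms(4)] assms(2)
    by (simp add: super_strongly_fractal_def)
qed

end
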